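(* Suppose $\mathbf f\equiv\mathbf 0$. Then the fully discrete SAV-MAC scheme (S1)-(S4) described in the context is unconditionally stable, in the sense that for any $\Delta t$ its solution satisfies the discrete energy law $$|Q^{n+1}|^2-|Q^n|^2=-\nu\,\Delta t\,\|D\mathbf U^{n+1/2}\|^2\qquad\text{for all } n\ge0.$$
   Context: $\Omega=(L_{lx},L_{rx})\times(L_{ly},L_{ry})\subset\mathbb R^2$, $\nu>0$, $\delta>0$ fixed constants; the scheme approximates the incompressible Navier-Stokes equations $\partial_t\mathbf u+\mathbf u\cdot\nabla\mathbf u-\nu\Delta\mathbf u+\nabla p=\mathbf f$, $\nabla\cdot\mathbf u=0$ in $\Omega\times(0,T]$, $\mathbf u=\mathbf 0$ on $\partial\Omega$, with initial value $\mathbf u^0=(u_1^0,u_2^0)$. $E(\mathbf u)=\int_\Omega\frac12|\mathbf u|^2$. Grid. Uniform mesh $x_i=L_{lx}+ih$ ($0\le i\le N_x$, $x_{N_x}=L_{rx}$), $y_j=L_{ly}+jk$ ($0\le j\le N_y$, $y_{N_y}=L_{ry}$), midpoints $x_{i+1/2},y_{j+1/2}$, with the convention $x_{-1/2}=x_0$, $x_{N_x+1/2}=x_{N_x}$, $y_{-1/2}=y_0$, $y_{N_y+1/2}=y_{N_y}$. $h_i=x_{i+1/2}-x_{i-1/2}$, $k_j=y_{j+1/2}-y_{j-1/2}$ (so $h_i=h$, $k_j=k$ in the interior, $h_0=h_{N_x}=h/2$, $k_0=k_{N_y}=k/2$). $f_{l,m}$ denotes the value at $(x_l,y_m)$. First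 velocity components live at $(x_i,y_{j+1/2})$, second components at $(x_{i+1/2},y_j)$, pressures at $(x_{i+1/2},y_{j+1/2})$. Differences: $[d_xf]_{i+1/2,m}=(f_{i+1,m}-f_{i,m})/h$, $[D_xf]_{i,m}=(f_{i+1/2,m}-f_{i-1/2,m})/h_i$, $[d_yf]_{l,j+1/2}=(f_{l,j+1}-f_{l,j})/k$, $[D_yf]_{l,j}=(f_{l,j+1/2}-f_{l,j-1/2})/k_j$. Inner products (norms are the induced ones): $(f,g)_{l^2,M}=\sum_{i=0}^{N_x-1}\sum_{j=0}^{N_y-1}hk\,f_{i+1/2,j+1/2}g_{i+1/2,j+1/2}$; $(f,g)_{l^2,T_x}=\sum_{i=0}^{N_x}\sum_{j=1}^{N_y-1}h_ik_jf_{i,j}g_{i,j}$; $(f,g)_{l^2,T_y}=\sum_{i=1}^{N_x-1}\sum_{j=0}^{N_y}h_ik_jf_{i,j}g_{i,j}$; $(f,g)_{l^2,T,M}=\sum_{i=1}^{N_x-1}\sum_{j=0}^{N_y-1}hk\,f_{i,j+1/2}g_{i,j+1/2}$; $(f,g)_{l^2,M,T}=\sum_{i=0}^{N_x-1}\sum_{j=1}^{N_y-1}hk\,f_{i+1/2,j}g_{i+1/2,j}$. For vectors, $(\mathbf u,\mathbf v)_{l^2}=(u_1,v_1)_{l^2,T,M}+(u_2,v_2)_{l^2,M,T}$, $\|\mathbf u\|_{l^2}^2=(\mathbf u,\mathbf u)_{l^2}$, and $\|D\mathbf u\|^2=\|d_xu_1\|_{l^2,M}^2+\|D_yu_1\|_{l^2,T_y}^2+\|D_xu_2\|_{l^2,T_x}^2+\|d_yu_2\|_{l^2,M}^2$.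 Time. $\Delta t=T/N$, $t^n=n\Delta t$, $d_tf^{n+1}=(f^{n+1}-f^n)/\Delta t$, $f^{n+1/2}=(f^n+f^{n+1})/2$. Scheme. $\mathcal P_h$ is the bilinear interpolation operator (from the nodal values, boundary values included). For $n\ge0$, find $\mathbf U^{n+1}=(U_1^{n+1},U_2^{n+1})$, $P^{n+1}$, $Q^{n+1}$ with $Q^{n+1/2}\neq0$ such that (S1) $d_tU_1^{n+1}+\frac{Q^{n+1/2}}{B^{n+1/2}}\big(\tilde U_1^{n+1/2}D_x(\mathcal P_h\tilde U_1^{n+1/2})+\mathcal P_h\tilde U_2^{n+1/2}d_y(\mathcal P_h\tilde U_1^{n+1/2})\big)-\nu D_x(d_xU_1)^{n+1/2}-\nu d_y(D_yU_1)^{n+1/2}+[D_xP]^{n+1/2}=f_1^{n+1/2}$ at $(x_i,y_{j+1/2})$, $1\le i\le N_x-1$, $0\le j\le N_y-1$; (S2) $d_tU_2^{n+1}+\frac{Q^{n+1/2}}{B^{n+1/2}}\big(\mathcal P_h\tilde U_1^{n+1/2}d_x(\mathcal P_h\tilde U_2^{n+1/2})+\tilde U_2^{n+1/2}D_y(\mathcal P_h\tilde U_2^{n+1/2})\big)-\nu D_y(d_yU_2)^{n+1/2}-\nu d_x(D_xU_2)^{n+1/2}+[D_yP]^{n+1/2}=f_2^{n+1/2}$ at $(x_{i+1/2},y_j)$, $0\le i\le N_x-1$, $1\le j\le N_y-1$; (S3) $d_tQ^{n+1}=\frac1{2B^{n+1/2}}(\mathcal P_h\tilde{\mathbf U}^{n+1/2}\cdot\nabla_h(\mathcal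 P_h\tilde{\mathbf U}^{n+1/2}),\mathbf U^{n+1/2})_{l^2}+\frac1{2Q^{n+1/2}}(d_t\mathbf U^{n+1},\mathbf U^{n+1/2})_{l^2}$; (S4) $d_xU_1^{n+1}+d_yU_2^{n+1}=0$ at all cell centers. Here $\mathcal P_h\tilde{\mathbf U}\cdot\nabla_h(\mathcal P_h\tilde{\mathbf U})$ is the vector whose components are the two large brackets in (S1), (S2); $B^{n+1/2}=\sqrt{\frac12\|\tilde{\mathbf U}^{n+1/2}\|_{l^2}^2+\delta}$; $\tilde{\mathbf U}^{n+1/2}=(3\mathbf U^n-\mathbf U^{n-1})/2$ for $n\ge1$, and $\tilde{\mathbf U}^{1/2}$ is given by the MAC discretization (same spatial operators, zero boundary values, zero discrete divergence) of the first-order scheme $\frac{\tilde{\mathbf u}^{1/2}-\mathbf u^0}{\Delta t/2}+\mathbf u^0\cdot\nabla\mathbf u^0-\nu\Delta\tilde{\mathbf u}^{1/2}+\nabla p^{1/2}=\mathbf f^{1/2}$. Boundary conditions for all $n$: $U^n_{1,0,j+1/2}=U^n_{1,N_x,j+1/2}=0$, $U^n_{1,i,0}=U^n_{1,i,N_y}=0$, $U^n_{2,0,j}=U^n_{2,N_x,j}=0$, $U^n_{2,i+1/2,0}=U^n_{2,i+1/2,N_y}=0$ (values at $y_0,y_{N_y}$, resp. $x_0,x_{N_x}$, serve as the index $-1/2$ and $N_y+1/2$, resp. $N_x+1/2$, values in $D_yU_1$, $D_xU_2$). Initial conditions: $\mathbf U^0$ is given by the nodal values of $\mathbf u^0$ and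 $Q^0=\sqrt{E(\mathbf u^0)+\delta}$.
   Formalization: For n = 0 the formal statement also assumes that the initial grid velocity U^0 is discretely divergence-free; (S4) does not impose this, nodal values of a solenoidal u^0 need not satisfy it, and without it the law can fail at n = 0. For n ≥ 1 nothing is added. *)

theory Defs
  imports "HOL-Analysis.Analysis"
begin

record mac_grid =
  Llx :: real
  Lrx :: real
  Lly :: real
  Lry :: real
  Nx :: nat
  Ny :: nat

definition mac_grid_ok :: "mac_grid \<Rightarrow> bool" where
  "mac_grid_ok G \<longleftrightarrow> Llx G < Lrx G \<and> Lly G < Lry G \<and> 1 \<le> Nx G \<and> 1 \<le> Ny G"

definition Omega :: "mac_grid \<Rightarrow> (real \<times> real) set" where
  "Omega G = {Llx G <..< Lrx G} \<times> {Lly G <..< Lry G}"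

definition hx :: "mac_grid \<Rightarrow> real" where
  "hx G = (Lrx G - Llx G) / real (Nx G)"

definition ky :: "mac_grid \<Rightarrow> real" where
  "ky G = (Lry G - Lly G) / real (Ny G)"

text \<open>
  Grid functions use doubled indices: \<open>f a b\<close> is the value at \<open>(x_{a/2}, y_{b/2})\<close>, so that
  \<open>x_i\<close> has index \<open>2 i\<close> and \<open>x_{i+1/2}\<close> has index \<open>2 i + 1\<close>. A given grid function is
  only meaningful at the indices of its own staggered nodes (and at its boundary nodes).
  The conventions \<open>x_{-1/2} = x_0\<close>, \<open>x_{N_x+1/2} = x_{N_x}\<close> (and the same in \<open>y\<close>) are
  implemented by clamping an index to \<open>0, ..., 2 N_x\<close>; in particular the boundary values serve
  as the values with index \<open>-1/2\<close> and \<open>N_x + 1/2\<close>.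
\<close>

type_synonym gridfun = "int \<Rightarrow> int \<Rightarrow> real"

definition clx :: "mac_grid \<Rightarrow> int \<Rightarrow> int" where
  "clx G a = max 0 (min (2 * int (Nx G)) a)"

definition cly :: "mac_grid \<Rightarrow> int \<Rightarrow> int" where
  "cly G b = max 0 (min (2 * int (Ny G)) b)"

definition xpt :: "mac_grid \<Rightarrow> int \<Rightarrow> real" where
  "xpt G a = Llx G + hx G * (real_of_int (clx G a) / 2)"

definition ypt :: "mac_grid \<Rightarrow> int \<Rightarrow> real" where
  "ypt G b = Lly G + ky G * (real_of_int (cly G b) / 2)"

text \<open>At an even index \<open>2 i\<close> these are \<open>h_i = x_{i+1/2} - x_{i-1/2}\<close> and
  \<open>k_j = y_{j+1/2} - y_{j-1/2}\<close>.\<close>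

definition hxi :: "mac_grid \<Rightarrow> int \<Rightarrow> real" where
  "hxi G a = xpt G (a + 1) - xpt G (a - 1)"

definition kyj :: "mac_grid \<Rightarrow> int \<Rightarrow> real" where
  "kyj G b = ypt G (b + 1) - ypt G (b - 1)"

text \<open>\<open>dx\<close>, \<open>dy\<close> are used at odd indices of the differentiated variable (cell midpoints),
  \<open>Dx\<close>, \<open>Dy\<close> at even ones.\<close>

definition dx :: "mac_grid \<Rightarrow> gridfun \<Rightarrow> gridfun" where
  "dx G f a b = (f (a + 1) b - f (a - 1) b) / hx G"

definition Dx :: "mac_grid \<Rightarrow> gridfun \<Rightarrow> gridfun" where
  "Dx G f a b = (f (clx G (a + 1)) b - f (clx G (a - 1)) b) / hxi G a"

definition dy :: "mac_grid \<Rightarrow> gridfun \<Rightarrow> gridfun" where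
  "dy G f a b = (f a (b + 1) - f a (b - 1)) / ky G"

definition Dy :: "mac_grid \<Rightarrow> gridfun \<Rightarrow> gridfun" where
  "Dy G f a b = (f a (cly G (b + 1)) - f a (cly G (b - 1))) / kyj G b"

definition ip_M :: "mac_grid \<Rightarrow> gridfun \<Rightarrow> gridfun \<Rightarrow> real" where
  "ip_M G f g = (\<Sum>i<Nx G. \<Sum>j<Ny G. hx G * ky G
      * f (2 * int i + 1) (2 * int j + 1) * g (2 * int i + 1) (2 * int j + 1))"

definition ip_Tx :: "mac_grid \<Rightarrow> gridfun \<Rightarrow> gridfun \<Rightarrow> real" where
  "ip_Tx G f g = (\<Sum>i\<le>Nx G. \<Sum>j=1..<Ny G. hxi G (2 * int i) * kyj G (2 * int j)
      * f (2 * int i) (2 * int j) * g (2 * int i) (2 * int j))"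

definition ip_Ty :: "mac_grid \<Rightarrow> gridfun \<Rightarrow> gridfun \<Rightarrow> real" where
  "ip_Ty G f g = (\<Sum>i=1..<Nx G. \<Sum>j\<le>Ny G. hxi G (2 * int i) * kyj G (2 * int j)
      * f (2 * int i) (2 * int j) * g (2 * int i) (2 * int j))"

definition ip_TM :: "mac_grid \<Rightarrow> gridfun \<Rightarrow> gridfun \<Rightarrow> real" where
  "ip_TM G f g = (\<Sum>i=1..<Nx G. \<Sum>j<Ny G. hx G * ky G
      * f (2 * int i) (2 * int j + 1) * g (2 * int i) (2 * int j + 1))"

definition ip_MT :: "mac_grid \<Rightarrow> gridfun \<Rightarrow> gridfun \<Rightarrow> real" where
  "ip_MT G f g = (\<Sum>i<Nx G. \<Sum>j=1..<Ny G. hx G * ky G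
      * f (2 * int i + 1) (2 * int j) * g (2 * int i + 1) (2 * int j))"

definition ip_l2 :: "mac_grid \<Rightarrow> gridfun \<times> gridfun \<Rightarrow> gridfun \<times> gridfun \<Rightarrow> real" where
  "ip_l2 G u v = ip_TM G (fst u) (fst v) + ip_MT G (snd u) (snd v)"

definition norm_D_sq :: "mac_grid \<Rightarrow> gridfun \<times> gridfun \<Rightarrow> real" where
  "norm_D_sq G u =
     ip_M G (dx G (fst u)) (dx G (fst u)) + ip_Ty G (Dy G (fst u)) (Dy G (fst u))
   + ip_Tx G (Dx G (snd u)) (Dx G (snd u)) + ip_M G (dy G (snd u)) (dy G (snd u))"

text \<open>Linear interpolation at \<open>x_{a/2}\<close> from the two adjacent nodes \<open>x_{(a-1)/2}\<close> and
  \<open>x_{(a+1)/2}\<close>. At a boundary point the clamped node is the point itself, so the result is the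
  boundary value.\<close>

definition lin_x :: "mac_grid \<Rightarrow> gridfun \<Rightarrow> gridfun" where
  "lin_x G f a b =
     ((xpt G (a + 1) - xpt G a) * f (clx G (a - 1)) b
      + (xpt G a - xpt G (a - 1)) * f (clx G (a + 1)) b) / (xpt G (a + 1) - xpt G (a - 1))"

definition lin_y :: "mac_grid \<Rightarrow> gridfun \<Rightarrow> gridfun" where
  "lin_y G f a b =
     ((ypt G (b + 1) - ypt G b) * f a (cly G (b - 1))
      + (ypt G b - ypt G (b - 1)) * f a (cly G (b + 1))) / (ypt G (b + 1) - ypt G (b - 1))"

text \<open>The bilinear interpolation operator, evaluated at grid points only, is the tensor product of
  the two linear interpolations. It depends on the staggered location of its argument: first
  components have the nodes \<open>(x_i, y_{j+1/2})\<close> together with \<open>(x_i, y_0)\<close>, \<open>(x_i, y_{N_y})\<close>;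
  second components the nodes \<open>(x_{i+1/2}, y_j)\<close> together with \<open>(x_0, y_j)\<close>, \<open>(x_{N_x}, y_j)\<close>.\<close>

definition Ph1 :: "mac_grid \<Rightarrow> gridfun \<Rightarrow> gridfun" where
  "Ph1 G f =
     (let g = (\<lambda>a b. if even a then f a b else lin_x G f a b)
      in (\<lambda>a b. if odd b then g a b else lin_y G g a b))"

definition Ph2 :: "mac_grid \<Rightarrow> gridfun \<Rightarrow> gridfun" where
  "Ph2 G f =
     (let g = (\<lambda>a b. if odd a then f a b else lin_x G f a b)
      in (\<lambda>a b. if even b then g a b else lin_y G g a b))"

definition conv1 :: "mac_grid \<Rightarrow> gridfun \<times> gridfun \<Rightarrow> gridfun" where
  "conv1 G u a b =
     fst u a b * Dx G (Ph1 G (fst u)) a b + Ph2 G (snd u) a b * dy G (Ph1 G (fst u)) a b"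

definition conv2 :: "mac_grid \<Rightarrow> gridfun \<times> gridfun \<Rightarrow> gridfun" where
  "conv2 G u a b =
     Ph1 G (fst u) a b * dx G (Ph2 G (snd u)) a b + snd u a b * Dy G (Ph2 G (snd u)) a b"

definition lap1 :: "mac_grid \<Rightarrow> gridfun \<Rightarrow> gridfun" where
  "lap1 G u a b = Dx G (dx G u) a b + dy G (Dy G u) a b"

definition lap2 :: "mac_grid \<Rightarrow> gridfun \<Rightarrow> gridfun" where
  "lap2 G u a b = Dy G (dy G u) a b + dx G (Dx G u) a b"

definition zero_bc :: "mac_grid \<Rightarrow> gridfun \<times> gridfun \<Rightarrow> bool" where
  "zero_bc G u \<longleftrightarrow>
     (\<forall>j<Ny G. fst u 0 (2 * int j + 1) = 0 \<and> fst u (2 * int (Nx G)) (2 * int j + 1) = 0) \<and>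
     (\<forall>i\<le>Nx G. fst u (2 * int i) 0 = 0 \<and> fst u (2 * int i) (2 * int (Ny G)) = 0) \<and>
     (\<forall>j\<le>Ny G. snd u 0 (2 * int j) = 0 \<and> snd u (2 * int (Nx G)) (2 * int j) = 0) \<and>
     (\<forall>i<Nx G. snd u (2 * int i + 1) 0 = 0 \<and> snd u (2 * int i + 1) (2 * int (Ny G)) = 0)"

definition discrete_div_free :: "mac_grid \<Rightarrow> gridfun \<times> gridfun \<Rightarrow> bool" where
  "discrete_div_free G u \<longleftrightarrow>
     (\<forall>i<Nx G. \<forall>j<Ny G. dx G (fst u) (2 * int i + 1) (2 * int j + 1)
                        + dy G (snd u) (2 * int i + 1) (2 * int j + 1) = 0)"

definition at_half :: "(nat \<Rightarrow> gridfun) \<Rightarrow> nat \<Rightarrow> gridfun" where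
  "at_half F n = (\<lambda>a b. (F n a b + F (Suc n) a b) / 2)"

definition dt_diff :: "real \<Rightarrow> (nat \<Rightarrow> gridfun) \<Rightarrow> nat \<Rightarrow> gridfun" where
  "dt_diff dt F n = (\<lambda>a b. (F (Suc n) a b - F n a b) / dt)"

definition source1 :: "mac_grid \<Rightarrow> real \<Rightarrow> (real \<Rightarrow> real \<times> real \<Rightarrow> real \<times> real) \<Rightarrow> nat \<Rightarrow> gridfun" where
  "source1 G dt f n = (\<lambda>a b. fst (f (real n * dt) (xpt G a, ypt G b)))"

definition source2 :: "mac_grid \<Rightarrow> real \<Rightarrow> (real \<Rightarrow> real \<times> real \<Rightarrow> real \<times> real) \<Rightarrow> nat \<Rightarrow> gridfun" where
  "source2 G dt f n = (\<lambda>a b. snd (f (real n * dt) (xpt G a, ypt G b)))"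

text \<open>The value \<open>W\<close> at time level \<open>1/2\<close> comes from the first-order scheme below.\<close>

definition extrap :: "gridfun \<Rightarrow> (nat \<Rightarrow> gridfun) \<Rightarrow> nat \<Rightarrow> gridfun" where
  "extrap W U n = (case n of 0 \<Rightarrow> W | Suc m \<Rightarrow> (\<lambda>a b. (3 * U (Suc m) a b - U m a b) / 2))"

definition kinetic_energy :: "mac_grid \<Rightarrow> (real \<times> real \<Rightarrow> real \<times> real) \<Rightarrow> real" where
  "kinetic_energy G u = (LINT z:Omega G|lborel. 1/2 * (norm (u z))\<^sup>2)"

text \<open>At boundary nodes the nodal values of the initial datum are the zero boundary values, which are
  imposed through \<open>zero_bc\<close>.\<close>

definition initial_values ::
  "mac_grid \<Rightarrow> real \<Rightarrow> (real \<times> real \<Rightarrow> real \<times> real) \<Rightarrow> gridfun \<times> gridfun \<Rightarrow> real \<Rightarrow> bool" where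
  "initial_values G \<delta> u0 v q \<longleftrightarrow>
     (\<forall>i\<in>{1..<Nx G}. \<forall>j<Ny G. fst v (2 * int i) (2 * int j + 1)
          = fst (u0 (xpt G (2 * int i), ypt G (2 * int j + 1)))) \<and>
     (\<forall>i<Nx G. \<forall>j\<in>{1..<Ny G}. snd v (2 * int i + 1) (2 * int j)
          = snd (u0 (xpt G (2 * int i + 1), ypt G (2 * int j)))) \<and>
     q = sqrt (kinetic_energy G u0 + \<delta>)"

text \<open>\<open>v\<close> is the initial grid velocity, \<open>w\<close> the velocity and \<open>p\<close> the pressure at time
  level \<open>1/2\<close>.\<close>

definition first_order_start ::
  "mac_grid \<Rightarrow> real \<Rightarrow> real \<Rightarrow> (real \<Rightarrow> real \<times> real \<Rightarrow> real \<times> real) \<Rightarrow>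
   gridfun \<times> gridfun \<Rightarrow> gridfun \<times> gridfun \<Rightarrow> gridfun \<Rightarrow> bool" where
  "first_order_start G \<nu> dt f v w p \<longleftrightarrow>
     (\<forall>i\<in>{1..<Nx G}. \<forall>j<Ny G. let a = 2 * int i; b = 2 * int j + 1 in
        (fst w a b - fst v a b) / (dt / 2) + conv1 G v a b - \<nu> * lap1 G (fst w) a b + Dx G p a b
          = at_half (source1 G dt f) 0 a b) \<and>
     (\<forall>i<Nx G. \<forall>j\<in>{1..<Ny G}. let a = 2 * int i + 1; b = 2 * int j in
        (snd w a b - snd v a b) / (dt / 2) + conv2 G v a b - \<nu> * lap2 G (snd w) a b + Dy G p a b
          = at_half (source2 G dt f) 0 a b) \<and>
     zero_bc G w \<and> discrete_div_free G w"

text \<open>One time step \<open>n \<rightarrow> n + 1\<close>; \<open>w\<close> is the extrapolated velocity at level \<open>n + 1/2\<close>.\<close>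

definition sav_mac_step ::
  "mac_grid \<Rightarrow> real \<Rightarrow> real \<Rightarrow> real \<Rightarrow> (real \<Rightarrow> real \<times> real \<Rightarrow> real \<times> real) \<Rightarrow>
   (nat \<Rightarrow> gridfun) \<Rightarrow> (nat \<Rightarrow> gridfun) \<Rightarrow> (nat \<Rightarrow> gridfun) \<Rightarrow> (nat \<Rightarrow> real) \<Rightarrow>
   gridfun \<times> gridfun \<Rightarrow> nat \<Rightarrow> bool" where
  "sav_mac_step G \<nu> \<delta> dt f U1 U2 P Q w n \<longleftrightarrow>
     (let B = sqrt (1/2 * ip_l2 G w w + \<delta>);
          Qh = (Q n + Q (Suc n)) / 2;
          Uh = (at_half U1 n, at_half U2 n)
      in Qh \<noteq> 0 \<and>
        (\<forall>i\<in>{1..<Nx G}. \<forall>j<Ny G. let a = 2 * int i; b = 2 * int j + 1 in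
           dt_diff dt U1 n a b + Qh / B * conv1 G w a b - \<nu> * lap1 G (fst Uh) a b
             + Dx G (at_half P n) a b = at_half (source1 G dt f) n a b) \<and>
        (\<forall>i<Nx G. \<forall>j\<in>{1..<Ny G}. let a = 2 * int i + 1; b = 2 * int j in
           dt_diff dt U2 n a b + Qh / B * conv2 G w a b - \<nu> * lap2 G (snd Uh) a b
             + Dy G (at_half P n) a b = at_half (source2 G dt f) n a b) \<and>
        (Q (Suc n) - Q n) / dt
           = 1 / (2 * B) * ip_l2 G (conv1 G w, conv2 G w) Uh
           + 1 / (2 * Qh) * ip_l2 G (dt_diff dt U1 n, dt_diff dt U2 n) Uh \<and>
        discrete_div_free G (U1 (Suc n), U2 (Suc n)))"

definition sav_mac_solution ::
  "mac_grid \<Rightarrow> real \<Rightarrow> real \<Rightarrow> real \<Rightarrow> nat \<Rightarrow> (real \<Rightarrow> real \<times> real \<Rightarrow> real \<times> real) \<Rightarrow>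
   (real \<times> real \<Rightarrow> real \<times> real) \<Rightarrow> gridfun \<times> gridfun \<Rightarrow> gridfun \<Rightarrow>
   (nat \<Rightarrow> gridfun) \<Rightarrow> (nat \<Rightarrow> gridfun) \<Rightarrow> (nat \<Rightarrow> gridfun) \<Rightarrow> (nat \<Rightarrow> real) \<Rightarrow> bool" where
  "sav_mac_solution G \<nu> \<delta> dt N f u0 w p U1 U2 P Q \<longleftrightarrow>
     initial_values G \<delta> u0 (U1 0, U2 0) (Q 0) \<and>
     (\<forall>n\<le>N. zero_bc G (U1 n, U2 n)) \<and>
     first_order_start G \<nu> dt f (U1 0, U2 0) w p \<and>
     (\<forall>n<N. sav_mac_step G \<nu> \<delta> dt f U1 U2 P Q
               (extrap (fst w) U1 n, extrap (snd w) U2 n) n)"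

end

theory Submission
  imports Defs
begin

text \<open>
  The law is the energy argument for the continuous equations, carried out on the grid. Testing the
  momentum equations with the midpoint velocity \<open>U\<close> at level \<open>n + 1/2\<close> gives
  \<open>(d_t U, U) + Q/B (convection, U) = \<nu> (Laplacian U, U) - (grad P, U)\<close>, where \<open>Q\<close> is the midpoint
  value of the auxiliary variable. Multiplying its evolution equation by \<open>2 Q\<close> shows
  that the same left side equals \<open>((Q\<^sup>n\<^sup>+\<^sup>1)\<^sup>2 - (Q\<^sup>n)\<^sup>2) / \<Delta>t\<close>: the scalar equation is
  built so that the explicitly treated convection cancels algebraically.

  What is left is summation by parts on the staggered grid. It turns the Laplacian into minus
  \<open>norm_D_sq\<close> (\<open>inner_lap1\<close>, \<open>inner_lap2\<close>) and the pressure term into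
  \<open>(P, div U)\<close>, which vanishes because \<open>U\<close> is the mean of two discretely divergence-free fields.
  One Abel identity serves both ways of testing with a grid function \<open>u\<close>. If \<open>u\<close> has boundary nodes in the
  direction of differentiation, the sum runs over interior nodes on one side and over cells on the
  other. If \<open>u\<close> lives at cell midpoints in that direction, the sum over nodes includes the two
  boundary half cells. There the weight \<open>h/2\<close> cancels the denominator of the one-sided difference, so
  that boundary and interior summands have the same form.
\<close>

section \<open>Summation by parts in one dimension\<close>

lemma abel_summation:
  fixes g a :: "nat \<Rightarrow> real"
  shows "(\<Sum>i<m. (g (Suc i) - g i) * a (Suc i)) + (\<Sum>i\<le>m. g i * (a (Suc i) - a i))
           = g m * a (Suc m) - g 0 * a 0"
  by (induction m) (auto simp: algebra_simps)

lemma sum_parts_nodes: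
  fixes q u :: "int \<Rightarrow> real"
  assumes "1 \<le> n" and "u 0 = 0" and "u (2 * int n) = 0"
  shows "(\<Sum>i=1..<n. (q (2 * int i + 1) - q (2 * int i - 1)) * u (2 * int i))
           = - (\<Sum>i<n. q (2 * int i + 1) * (u (2 * int i + 2) - u (2 * int i)))"
proof -
  obtain m where n: "n = Suc m"
    using assms(1) by (cases n) auto
  have "(\<Sum>i=1..<n. (q (2 * int i + 1) - q (2 * int i - 1)) * u (2 * int i))
      = (\<Sum>i<m. (q (2 * int (Suc i) + 1) - q (2 * int i + 1)) * u (2 * int (Suc i)))"
    unfolding n One_nat_def sum.shift_bounds_Suc_ivl by (simp add: atLeast0LessThan algebra_simps)
  moreover have "(\<Sum>i<n. q (2 * int i + 1) * (u (2 * int i + 2) - u (2 * int i)))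
      = (\<Sum>i\<le>m. q (2 * int i + 1) * (u (2 * int (Suc i)) - u (2 * int i)))"
    unfolding n lessThan_Suc_atMost by (simp add: algebra_simps)
  ultimately show ?thesis
    using abel_summation[of "\<lambda>i. q (2 * int i + 1)" "\<lambda>i. u (2 * int i)" m] assms(2,3) n by simp
qed

text \<open>The clamped indices make the boundary values play the role of the midpoint values with index
  \<open>-1/2\<close> and \<open>n + 1/2\<close>; since those vanish, Abel summation leaves no boundary term.\<close>

lemma sum_parts_midpoints:
  fixes g v :: "int \<Rightarrow> real" and n :: nat
  defines "c \<equiv> \<lambda>b. max 0 (min (2 * int n) b)"
  assumes "v 0 = 0" and "v (2 * int n) = 0"
  shows "(\<Sum>j<n. (g (2 * int j + 2) - g (2 * int j)) * v (2 * int j + 1))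
           = - (\<Sum>j\<le>n. g (2 * int j) * (v (c (2 * int j + 1)) - v (c (2 * int j - 1))))"
proof -
  have "(\<Sum>j<n. (g (2 * int j + 2) - g (2 * int j)) * v (2 * int j + 1))
      = (\<Sum>j<n. (g (2 * int (Suc j)) - g (2 * int j)) * v (c (2 * int (Suc j) - 1)))"
    by (rule sum.cong) (auto simp: c_def algebra_simps)
  moreover have "(\<Sum>j\<le>n. g (2 * int j) * (v (c (2 * int j + 1)) - v (c (2 * int j - 1))))
      = (\<Sum>j\<le>n. g (2 * int j) * (v (c (2 * int (Suc j) - 1)) - v (c (2 * int j - 1))))"
    by (simp add: algebra_simps)
  moreover have "v (c (2 * int (Suc n) - 1)) = 0" "v (c (2 * int 0 - 1)) = 0"
    using assms(2,3) by (simp_all add: c_def)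
  ultimately show ?thesis
    using abel_summation[of "\<lambda>j. g (2 * int j)" "\<lambda>j. v (c (2 * int j - 1))" n] by simp
qed

section \<open>Mesh widths\<close>

lemma hx_pos: "mac_grid_ok G \<Longrightarrow> hx G > 0"
  by (simp add: mac_grid_ok_def hx_def)

lemma ky_pos: "mac_grid_ok G \<Longrightarrow> ky G > 0"
  by (simp add: mac_grid_ok_def ky_def)

lemma xpt_strict_mono:
  assumes "mac_grid_ok G" and "clx G a < clx G b"
  shows "xpt G a < xpt G b"
  using assms hx_pos[OF assms(1)] by (simp add: xpt_def)

lemma ypt_strict_mono:
  assumes "mac_grid_ok G" and "cly G a < cly G b"
  shows "ypt G a < ypt G b"
  using assms ky_pos[OF assms(1)] by (simp add: ypt_def)

lemma hxi_pos:
  assumes "mac_grid_ok G" and "i \<le> Nx G"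
  shows "hxi G (2 * int i) > 0"
  using assms xpt_strict_mono[OF assms(1), of "2 * int i - 1" "2 * int i + 1"]
  by (simp add: hxi_def clx_def mac_grid_ok_def)

lemma kyj_pos:
  assumes "mac_grid_ok G" and "j \<le> Ny G"
  shows "kyj G (2 * int j) > 0"
  using assms ypt_strict_mono[OF assms(1), of "2 * int j - 1" "2 * int j + 1"]
  by (simp add: kyj_def cly_def mac_grid_ok_def)

lemma clx_inner: "0 \<le> a \<Longrightarrow> a \<le> 2 * int (Nx G) \<Longrightarrow> clx G a = a"
  by (simp add: clx_def)

lemma cly_inner: "0 \<le> b \<Longrightarrow> b \<le> 2 * int (Ny G) \<Longrightarrow> cly G b = b"
  by (simp add: cly_def)

lemma hxi_inner: "1 \<le> i \<Longrightarrow> i < Nx G \<Longrightarrow> hxi G (2 * int i) = hx G"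
  by (simp add: hxi_def xpt_def clx_inner field_simps)

lemma kyj_inner: "1 \<le> j \<Longrightarrow> j < Ny G \<Longrightarrow> kyj G (2 * int j) = ky G"
  by (simp add: kyj_def ypt_def cly_inner field_simps)

lemma inner_point_in_Omega:
  assumes "mac_grid_ok G" and "0 < a" "a < 2 * int (Nx G)" and "0 < b" "b < 2 * int (Ny G)"
  shows "(xpt G a, ypt G b) \<in> Omega G"
proof -
  have N: "Nx G \<ge> 1" "Ny G \<ge> 1"
    using assms(1) by (auto simp: mac_grid_ok_def)
  have ends: "xpt G 0 = Llx G" "xpt G (2 * int (Nx G)) = Lrx G"
       "ypt G 0 = Lly G" "ypt G (2 * int (Ny G)) = Lry G"
    using N by (simp_all add: xpt_def ypt_def clx_def cly_def hx_def ky_def)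
  have "xpt G 0 < xpt G a" "xpt G a < xpt G (2 * int (Nx G))"
    by (rule xpt_strict_mono[OF assms(1)]; use assms in \<open>simp add: clx_def\<close>)+
  moreover have "ypt G 0 < ypt G b" "ypt G b < ypt G (2 * int (Ny G))"
    by (rule ypt_strict_mono[OF assms(1)]; use assms in \<open>simp add: cly_def\<close>)+
  ultimately show ?thesis
    by (simp add: Omega_def ends)
qed

section \<open>Discrete Green identities\<close>

lemma inner_Dx_TM:
  assumes "mac_grid_ok G"
    and bc: "\<And>j. j < Ny G \<Longrightarrow> u 0 (2 * int j + 1) = 0 \<and> u (2 * int (Nx G)) (2 * int j + 1) = 0"
  shows "ip_TM G (Dx G p) u = - ip_M G p (dx G u)"
proof -
  note h = hx_pos[OF assms(1)]
  have "ip_TM G (Dx G p) u = (\<Sum>j<Ny G. \<Sum>i=1..<Nx G. hx G * ky G *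
      Dx G p (2 * int i) (2 * int j + 1) * u (2 * int i) (2 * int j + 1))"
    unfolding ip_TM_def by (rule sum.swap)
  also have "\<dots> = (\<Sum>j<Ny G. ky G * (\<Sum>i=1..<Nx G.
      (p (2 * int i + 1) (2 * int j + 1) - p (2 * int i - 1) (2 * int j + 1))
        * u (2 * int i) (2 * int j + 1)))"
    unfolding sum_distrib_left
    by (intro sum.cong refl) (use h in \<open>simp add: Dx_def hxi_inner clx_inner\<close>)
  also have "\<dots> = (\<Sum>j<Ny G. - (ky G * (\<Sum>i<Nx G. p (2 * int i + 1) (2 * int j + 1)
      * (u (2 * int i + 2) (2 * int j + 1) - u (2 * int i) (2 * int j + 1)))))"
    using assms(1) bc
    by (intro sum.cong refl, subst sum_parts_nodes) (auto simp: mac_grid_ok_def)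
  also have "\<dots> = - (\<Sum>j<Ny G. \<Sum>i<Nx G. hx G * ky G * p (2 * int i + 1) (2 * int j + 1)
      * dx G u (2 * int i + 1) (2 * int j + 1))"
    unfolding sum_negf sum_distrib_left
    by (intro arg_cong[where f = uminus] sum.cong refl)
       (use h in \<open>simp add: dx_def field_simps\<close>)
  also have "\<dots> = - ip_M G p (dx G u)"
    unfolding ip_M_def by (subst sum.swap) (rule refl)
  finally show ?thesis .
qed

lemma inner_Dy_MT:
  assumes "mac_grid_ok G"
    and bc: "\<And>i. i < Nx G \<Longrightarrow> u (2 * int i + 1) 0 = 0 \<and> u (2 * int i + 1) (2 * int (Ny G)) = 0"
  shows "ip_MT G (Dy G p) u = - ip_M G p (dy G u)"
proof -
  note k = ky_pos[OF assms(1)]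
  have "ip_MT G (Dy G p) u = (\<Sum>i<Nx G. hx G * (\<Sum>j=1..<Ny G.
      (p (2 * int i + 1) (2 * int j + 1) - p (2 * int i + 1) (2 * int j - 1))
        * u (2 * int i + 1) (2 * int j)))"
    unfolding ip_MT_def sum_distrib_left
    by (intro sum.cong refl) (use k in \<open>simp add: Dy_def kyj_inner cly_inner\<close>)
  also have "\<dots> = (\<Sum>i<Nx G. - (hx G * (\<Sum>j<Ny G. p (2 * int i + 1) (2 * int j + 1)
      * (u (2 * int i + 1) (2 * int j + 2) - u (2 * int i + 1) (2 * int j)))))"
    using assms(1) bc
    by (intro sum.cong refl, subst sum_parts_nodes) (auto simp: mac_grid_ok_def)
  also have "\<dots> = - ip_M G p (dy G u)"
    unfolding ip_M_def sum_negf sum_distrib_left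
    by (intro arg_cong[where f = uminus] sum.cong refl)
       (use k in \<open>simp add: dy_def field_simps\<close>)
  finally show ?thesis .
qed

lemma inner_dy_TM:
  assumes "mac_grid_ok G"
    and bc: "\<And>i. i \<le> Nx G \<Longrightarrow> u (2 * int i) 0 = 0 \<and> u (2 * int i) (2 * int (Ny G)) = 0"
  shows "ip_TM G (dy G g) u = - ip_Ty G g (Dy G u)"
proof -
  note k = ky_pos[OF assms(1)]
  have "ip_TM G (dy G g) u = (\<Sum>i=1..<Nx G. hx G * (\<Sum>j<Ny G.
      (g (2 * int i) (2 * int j + 2) - g (2 * int i) (2 * int j)) * u (2 * int i) (2 * int j + 1)))"
    unfolding ip_TM_def sum_distrib_left
    by (intro sum.cong refl) (use k in \<open>simp add: dy_def add.commute\<close>)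
  also have "\<dots> = (\<Sum>i=1..<Nx G. - (hx G * (\<Sum>j\<le>Ny G. g (2 * int i) (2 * int j)
      * (u (2 * int i) (cly G (2 * int j + 1)) - u (2 * int i) (cly G (2 * int j - 1))))))"
    unfolding cly_def
    using bc by (intro sum.cong refl, subst sum_parts_midpoints) auto
  also have "\<dots> = - ip_Ty G g (Dy G u)"
    unfolding ip_Ty_def sum_negf sum_distrib_left
    by (intro arg_cong[where f = uminus] sum.cong refl)
       (use kyj_pos[OF assms(1)] in \<open>force simp: Dy_def hxi_inner\<close>)
  finally show ?thesis .
qed

lemma inner_dx_MT:
  assumes "mac_grid_ok G"
    and bc: "\<And>j. j \<le> Ny G \<Longrightarrow> u 0 (2 * int j) = 0 \<and> u (2 * int (Nx G)) (2 * int j) = 0"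
  shows "ip_MT G (dx G g) u = - ip_Tx G g (Dx G u)"
proof -
  note h = hx_pos[OF assms(1)]
  have "ip_MT G (dx G g) u = (\<Sum>j=1..<Ny G. \<Sum>i<Nx G. hx G * ky G *
      dx G g (2 * int i + 1) (2 * int j) * u (2 * int i + 1) (2 * int j))"
    unfolding ip_MT_def by (rule sum.swap)
  also have "\<dots> = (\<Sum>j=1..<Ny G. ky G * (\<Sum>i<Nx G.
      (g (2 * int i + 2) (2 * int j) - g (2 * int i) (2 * int j)) * u (2 * int i + 1) (2 * int j)))"
    unfolding sum_distrib_left
    by (intro sum.cong refl) (use h in \<open>simp add: dx_def add.commute\<close>)
  also have "\<dots> = (\<Sum>j=1..<Ny G. - (ky G * (\<Sum>i\<le>Nx G. g (2 * int i) (2 * int j)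
      * (u (clx G (2 * int i + 1)) (2 * int j) - u (clx G (2 * int i - 1)) (2 * int j)))))"
    unfolding clx_def
    using bc by (intro sum.cong refl, subst sum_parts_midpoints) auto
  also have "\<dots> = - (\<Sum>j=1..<Ny G. \<Sum>i\<le>Nx G. hxi G (2 * int i) * kyj G (2 * int j)
      * g (2 * int i) (2 * int j) * Dx G u (2 * int i) (2 * int j))"
    unfolding sum_negf sum_distrib_left
    by (intro arg_cong[where f = uminus] sum.cong refl)
       (use hxi_pos[OF assms(1)] in \<open>force simp: Dx_def kyj_inner\<close>)
  also have "\<dots> = - ip_Tx G g (Dx G u)"
    unfolding ip_Tx_def by (subst sum.swap) (rule refl)
  finally show ?thesis .
qed

lemma inner_lap1:
  assumes "mac_grid_ok G" and "zero_bc G u"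
  shows "ip_TM G (lap1 G (fst u)) (fst u)
    = - ip_M G (dx G (fst u)) (dx G (fst u)) - ip_Ty G (Dy G (fst u)) (Dy G (fst u))"
proof -
  have "ip_TM G (lap1 G (fst u)) (fst u)
      = ip_TM G (Dx G (dx G (fst u))) (fst u) + ip_TM G (dy G (Dy G (fst u))) (fst u)"
    by (simp add: ip_TM_def lap1_def algebra_simps sum.distrib)
  then show ?thesis
    using assms by (simp add: inner_Dx_TM inner_dy_TM zero_bc_def)
qed

lemma inner_lap2:
  assumes "mac_grid_ok G" and "zero_bc G u"
  shows "ip_MT G (lap2 G (snd u)) (snd u)
    = - ip_M G (dy G (snd u)) (dy G (snd u)) - ip_Tx G (Dx G (snd u)) (Dx G (snd u))"
proof -
  have "ip_MT G (lap2 G (snd u)) (snd u)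
      = ip_MT G (Dy G (dy G (snd u))) (snd u) + ip_MT G (dx G (Dx G (snd u))) (snd u)"
    by (simp add: ip_MT_def lap2_def algebra_simps sum.distrib)
  then show ?thesis
    using assms by (simp add: inner_Dy_MT inner_dx_MT zero_bc_def)
qed

lemma pressure_orthogonal:
  assumes "mac_grid_ok G" and "zero_bc G u" and "discrete_div_free G u"
  shows "ip_TM G (Dx G p) (fst u) + ip_MT G (Dy G p) (snd u) = 0"
proof -
  have "ip_M G p (dx G (fst u)) + ip_M G p (dy G (snd u)) = (\<Sum>i<Nx G. \<Sum>j<Ny G. hx G * ky G
      * p (2 * int i + 1) (2 * int j + 1) * (dx G (fst u) (2 * int i + 1) (2 * int j + 1)
          + dy G (snd u) (2 * int i + 1) (2 * int j + 1)))"
    by (simp add: ip_M_def ring_distribs sum.distrib)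
  also have "\<dots> = 0"
    using assms(3) by (simp add: discrete_div_free_def)
  finally show ?thesis
    using assms(1,2) by (simp add: inner_Dx_TM inner_Dy_MT zero_bc_def)
qed

section \<open>Testing the momentum equations\<close>

lemma zero_bc_at_half:
  assumes "zero_bc G (U1 n, U2 n)" and "zero_bc G (U1 (Suc n), U2 (Suc n))"
  shows "zero_bc G (at_half U1 n, at_half U2 n)"
  using assms by (simp add: zero_bc_def at_half_def)

lemma discrete_div_free_at_half:
  assumes "discrete_div_free G (U1 n, U2 n)" and "discrete_div_free G (U1 (Suc n), U2 (Suc n))"
  shows "discrete_div_free G (at_half U1 n, at_half U2 n)"
proof -
  have eq: "dx G (at_half U1 n) a b + dy G (at_half U2 n) a b
      = ((dx G (U1 n) a b + dy G (U2 n) a b)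
         + (dx G (U1 (Suc n)) a b + dy G (U2 (Suc n)) a b)) / 2" for a b
    by (simp add: dx_def dy_def at_half_def diff_divide_distrib add_divide_distrib)
  show ?thesis
    using assms unfolding discrete_div_free_def fst_conv snd_conv eq by simp
qed

lemma ip_TM_momentum:
  assumes "\<And>i j. 1 \<le> i \<Longrightarrow> i < Nx G \<Longrightarrow> j < Ny G \<Longrightarrow>
    d (2 * int i) (2 * int j + 1) + c * m (2 * int i) (2 * int j + 1)
      - \<nu> * l (2 * int i) (2 * int j + 1) + g (2 * int i) (2 * int j + 1) = 0"
  shows "ip_TM G d v + c * ip_TM G m v - \<nu> * ip_TM G l v + ip_TM G g v = 0"
proof -
  have "ip_TM G d v + c * ip_TM G m v - \<nu> * ip_TM G l v + ip_TM G g v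
      = (\<Sum>i=1..<Nx G. \<Sum>j<Ny G. hx G * ky G
          * (d (2 * int i) (2 * int j + 1) + c * m (2 * int i) (2 * int j + 1)
             - \<nu> * l (2 * int i) (2 * int j + 1) + g (2 * int i) (2 * int j + 1))
          * v (2 * int i) (2 * int j + 1))"
    by (simp add: ip_TM_def sum_distrib_left algebra_simps sum.distrib sum_subtractf)
  also have "\<dots> = 0"
    by (intro sum.neutral ballI) (use assms in auto)
  finally show ?thesis .
qed

lemma ip_MT_momentum:
  assumes "\<And>i j. i < Nx G \<Longrightarrow> 1 \<le> j \<Longrightarrow> j < Ny G \<Longrightarrow>
    d (2 * int i + 1) (2 * int j) + c * m (2 * int i + 1) (2 * int j)
      - \<nu> * l (2 * int i + 1) (2 * int j) + g (2 * int i + 1) (2 * int j) = 0"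
  shows "ip_MT G d v + c * ip_MT G m v - \<nu> * ip_MT G l v + ip_MT G g v = 0"
proof -
  have "ip_MT G d v + c * ip_MT G m v - \<nu> * ip_MT G l v + ip_MT G g v
      = (\<Sum>i<Nx G. \<Sum>j=1..<Ny G. hx G * ky G
          * (d (2 * int i + 1) (2 * int j) + c * m (2 * int i + 1) (2 * int j)
             - \<nu> * l (2 * int i + 1) (2 * int j) + g (2 * int i + 1) (2 * int j))
          * v (2 * int i + 1) (2 * int j))"
    by (simp add: ip_MT_def sum_distrib_left algebra_simps sum.distrib sum_subtractf)
  also have "\<dots> = 0"
    by (intro sum.neutral ballI) (use assms in auto)
  finally show ?thesis .
qed

text \<open>With \<open>C\<close> and \<open>D\<close> the convection and time-derivative terms tested with the midpoint velocity,
  the auxiliary equation times \<open>2 Qh\<close> and the tested momentum equations contain the same combination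
  \<open>Qh / B * C + D\<close>; equating the two eliminates it. The momentum equations are posed at interior
  points of the domain, so a force that vanishes on the open rectangle drops out.\<close>

lemma sav_mac_step_energy:
  assumes ok: "mac_grid_ok G" and "dt \<noteq> 0"
    and step: "sav_mac_step G \<nu> \<delta> dt f U1 U2 P Q w n"
    and bc: "zero_bc G (U1 n, U2 n)" "zero_bc G (U1 (Suc n), U2 (Suc n))"
    and div: "discrete_div_free G (U1 n, U2 n)"
    and f0: "\<And>z. z \<in> Omega G \<Longrightarrow> f (real n * dt) z = 0"
            "\<And>z. z \<in> Omega G \<Longrightarrow> f (real (Suc n) * dt) z = 0"
  shows "(Q (Suc n))\<^sup>2 - (Q n)\<^sup>2 = - \<nu> * dt * norm_D_sq G (at_half U1 n, at_half U2 n)"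
proof -
  define B where "B = sqrt (1/2 * ip_l2 G w w + \<delta>)"
  define Qh where "Qh = (Q n + Q (Suc n)) / 2"
  define V1 where "V1 = at_half U1 n"
  define V2 where "V2 = at_half U2 n"
  note step' = step[unfolded sav_mac_step_def Let_def, folded B_def Qh_def V1_def V2_def]
  have Qh: "Qh \<noteq> 0"
    and S3: "(Q (Suc n) - Q n) / dt = 1 / (2 * B) * ip_l2 G (conv1 G w, conv2 G w) (V1, V2)
           + 1 / (2 * Qh) * ip_l2 G (dt_diff dt U1 n, dt_diff dt U2 n) (V1, V2)"
    and div': "discrete_div_free G (U1 (Suc n), U2 (Suc n))"
    using step' by auto
  have src: "at_half (source1 G dt f) n a b = 0" "at_half (source2 G dt f) n a b = 0"
    if "0 < a" "a < 2 * int (Nx G)" "0 < b" "b < 2 * int (Ny G)" for a b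
    using f0[OF inner_point_in_Omega[OF ok that]]
    by (simp_all add: at_half_def source1_def source2_def)
  have M1: "ip_TM G (dt_diff dt U1 n) V1 + Qh / B * ip_TM G (conv1 G w) V1
      - \<nu> * ip_TM G (lap1 G V1) V1 + ip_TM G (Dx G (at_half P n)) V1 = 0"
    by (rule ip_TM_momentum) (use step' src in auto)
  have M2: "ip_MT G (dt_diff dt U2 n) V2 + Qh / B * ip_MT G (conv2 G w) V2
      - \<nu> * ip_MT G (lap2 G V2) V2 + ip_MT G (Dy G (at_half P n)) V2 = 0"
    by (rule ip_MT_momentum) (use step' src in auto)
  have bcV: "zero_bc G (V1, V2)"
    unfolding V1_def V2_def by (rule zero_bc_at_half[OF bc])
  have divV: "discrete_div_free G (V1, V2)"
    unfolding V1_def V2_def by (rule discrete_div_free_at_half[OF div div'])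
  have lap: "ip_TM G (lap1 G V1) V1 + ip_MT G (lap2 G V2) V2 = - norm_D_sq G (V1, V2)"
    using inner_lap1[OF ok bcV] inner_lap2[OF ok bcV] by (simp add: norm_D_sq_def)
  have pr: "ip_TM G (Dx G (at_half P n)) V1 + ip_MT G (Dy G (at_half P n)) V2 = 0"
    using pressure_orthogonal[OF ok bcV divV] by simp
  define C where "C = ip_l2 G (conv1 G w, conv2 G w) (V1, V2)"
  define D where "D = ip_l2 G (dt_diff dt U1 n, dt_diff dt U2 n) (V1, V2)"
  have tested: "D + Qh / B * C - \<nu> * (ip_TM G (lap1 G V1) V1 + ip_MT G (lap2 G V2) V2) = 0"
    using M1 M2 pr unfolding C_def D_def ip_l2_def fst_conv snd_conv distrib_left by linarith
  have "(Q (Suc n))\<^sup>2 - (Q n)\<^sup>2 = dt * (2 * Qh * ((Q (Suc n) - Q n) / dt))"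
    using \<open>dt \<noteq> 0\<close> by (simp add: Qh_def power2_eq_square square_diff_square_factored add.commute)
  also have "2 * Qh * ((Q (Suc n) - Q n) / dt) = Qh / B * C + D"
    unfolding S3 C_def[symmetric] D_def[symmetric] using Qh by (simp add: distrib_left)
  also have "\<dots> = - \<nu> * norm_D_sq G (V1, V2)"
    using tested unfolding lap by simp
  finally show ?thesis
    by (simp add: V1_def V2_def)
qed

section \<open>The discrete energy law\<close>

theorem theorem2p2:
  fixes G :: mac_grid and \<nu> \<delta> T dt :: real and N :: nat
    and f :: "real \<Rightarrow> real \<times> real \<Rightarrow> real \<times> real"
    and u0 :: "real \<times> real \<Rightarrow> real \<times> real"
    and w :: "gridfun \<times> gridfun" and p :: gridfun
    and U1 U2 P :: "nat \<Rightarrow> gridfun" and Q :: "nat \<Rightarrow> real"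
  assumes "mac_grid_ok G" and "\<nu> > 0" and "\<delta> > 0"
    and "T > 0" and "N \<ge> 1" and "dt = T / real N"
    and f_zero: "\<forall>t\<in>{0..T}. \<forall>z\<in>Omega G. f t z = 0"
    and solution: "sav_mac_solution G \<nu> \<delta> dt N f u0 w p U1 U2 P Q"
  shows "\<forall>n<N. (n = 0 \<longrightarrow> discrete_div_free G (U1 0, U2 0)) \<longrightarrow>
           \<bar>Q (Suc n)\<bar>\<^sup>2 - \<bar>Q n\<bar>\<^sup>2 = - \<nu> * dt * norm_D_sq G (at_half U1 n, at_half U2 n)"
proof (intro allI impI)
  fix n
  assume n: "n < N" and div0: "n = 0 \<longrightarrow> discrete_div_free G (U1 0, U2 0)"
  have step: "sav_mac_step G \<nu> \<delta> dt f U1 U2 P Q (extrap (fst w) U1 m, extrap (snd w) U2 m) m"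
    if "m < N" for m
    using solution that by (simp add: sav_mac_solution_def)
  have bc: "zero_bc G (U1 m, U2 m)" if "m \<le> N" for m
    using solution that by (simp add: sav_mac_solution_def)
  have f0: "f (real m * dt) z = 0" if "m \<le> N" "z \<in> Omega G" for m z
  proof -
    have "real m * T \<le> real N * T"
      using that \<open>T > 0\<close> by (intro mult_right_mono) auto
    then have "real m * T / real N \<le> T"
      using \<open>N \<ge> 1\<close> by (simp add: divide_le_eq mult.commute)
    then have "real m * dt \<in> {0..T}"
      using \<open>T > 0\<close> \<open>dt = T / real N\<close> by simp
    then show ?thesis
      using f_zero that by blast
  qed
  \<comment> \<open>For \<open>n > 0\<close> the previous step supplies the divergence constraint at level \<open>n\<close>.\<close>
  have div: "discrete_div_free G (U1 n, U2 n)"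
  proof (cases n)
    case 0
    then show ?thesis using div0 by simp
  next
    case (Suc m)
    then show ?thesis using step[of m] n by (simp add: sav_mac_step_def Let_def)
  qed
  have "dt \<noteq> 0"
    using \<open>T > 0\<close> \<open>N \<ge> 1\<close> \<open>dt = T / real N\<close> by simp
  then show "\<bar>Q (Suc n)\<bar>\<^sup>2 - \<bar>Q n\<bar>\<^sup>2 = - \<nu> * dt * norm_D_sq G (at_half U1 n, at_half U2 n)"
    using sav_mac_step_energy[OF assms(1) _ step[OF n] bc bc div f0 f0] n by simp
qed

end
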